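(* Let $n\ge 5$. The shell graph $S_n$ has maximal total chord length among all maximal outerplanar graphs with $n$ vertices; that is, $TCL(G)\le TCL(S_n)$ for every maximal outerplanar graph $G$ of order $n$.
   Context: A maximal outerplanar graph of order $n$ is regarded as a drawing consisting of an $n$-cycle $\mathcal{C}$ together with a triangulation (by non-crossing edges between vertices of $\mathcal{C}$) of the bounded region determined by $\mathcal{C}$. Edges not in $\mathcal{C}$ are chords; the length of a chord is the length of a shortest path in $\mathcal{C}$ between its endpoints; $TCL(G)$ is the sum of the lengths of all chords. The shell graph $S_n$ is obtained from the $n$-cycle with vertices $v_1,\dots,v_n$ in clockwise order by adding the chords $v_1v_3, v_1v_4,\dots,v_1v_{n-2}$.
   Formalization: The shell graph is taken with all chords v_1v_3,…,v_1v_{n-1}; with the list ending at v_1v_{n-2} it is not a triangulation and the claim fails (for n=5 its total chord length is 2, while every maximal outerplanar graph of order 5 has 4). *)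

theory Defs
  imports Main
begin

text \<open>A drawing is given by its outer cycle, as the list of the vertices in clockwise order,
  together with the set of all edges of the graph, the edges of the outer cycle included.\<close>

datatype 'a drawing = Drawing (outer_cycle: "'a list") (edges: "'a set set")

definition order :: "'a drawing \<Rightarrow> nat" where
  "order G = length (outer_cycle G)"

definition cycle_edges :: "'a list \<Rightarrow> 'a set set" where
  "cycle_edges vs = {{vs ! i, vs ! (Suc i mod length vs)} | i. i < length vs}"

text \<open>Two edges drawn inside the outer cycle are forced to cross iff their endpoints
  alternate around it; otherwise they can be drawn without crossing.\<close>

definition cross :: "'a list \<Rightarrow> 'a set \<Rightarrow> 'a set \<Rightarrow> bool" where
  "cross vs e f \<longleftrightarrow> (\<exists>a b c d. a < b \<and> b < c \<and> c < d \<and> d < length vs \<and>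
     (e = {vs ! a, vs ! c} \<and> f = {vs ! b, vs ! d} \<or>
      f = {vs ! a, vs ! c} \<and> e = {vs ! b, vs ! d}))"

definition outerplanar :: "'a drawing \<Rightarrow> bool" where
  "outerplanar G \<longleftrightarrow>
     distinct (outer_cycle G) \<and> 3 \<le> length (outer_cycle G) \<and>
     cycle_edges (outer_cycle G) \<subseteq> edges G \<and>
     edges G \<subseteq> {{u, v} | u v. u \<in> set (outer_cycle G) \<and> v \<in> set (outer_cycle G) \<and> u \<noteq> v} \<and>
     (\<forall>e\<in>edges G. \<forall>f\<in>edges G. \<not> cross (outer_cycle G) e f)"

text \<open>The chords triangulate the region bounded by the outer cycle iff they form a maximal
  set of pairwise non-crossing chords.\<close>

definition maximal_outerplanar :: "'a drawing \<Rightarrow> bool" where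
  "maximal_outerplanar G \<longleftrightarrow> outerplanar G \<and>
     (\<forall>F. edges G \<subseteq> F \<and> outerplanar (Drawing (outer_cycle G) F) \<longrightarrow> F = edges G)"

definition chords :: "'a drawing \<Rightarrow> 'a set set" where
  "chords G = edges G - cycle_edges (outer_cycle G)"

definition is_path :: "'a set set \<Rightarrow> 'a list \<Rightarrow> bool" where
  "is_path E p \<longleftrightarrow> p \<noteq> [] \<and> distinct p \<and> successively (\<lambda>u v. {u, v} \<in> E) p"

definition chord_length :: "'a drawing \<Rightarrow> 'a set \<Rightarrow> nat" where
  "chord_length G e =
     (LEAST k. \<exists>p. is_path (cycle_edges (outer_cycle G)) p \<and> e = {hd p, last p} \<and>
                   length p = Suc k)"

definition TCL :: "'a drawing \<Rightarrow> nat" where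
  "TCL G = (\<Sum>e\<in>chords G. chord_length G e)"

text \<open>The vertex \<open>v\<^sub>i\<close> is the number \<open>i\<close>. The last chord is \<open>v\<^sub>1v\<^sub>n\<^sub>-\<^sub>1\<close>: all \<open>n - 3\<close> chords at
  \<open>v\<^sub>1\<close> are needed to triangulate the \<open>n\<close>-cycle.\<close>

definition shell :: "nat \<Rightarrow> nat drawing" where
  "shell n = Drawing [1..<Suc n] (cycle_edges [1..<Suc n] \<union> {{1, i} | i. 3 \<le> i \<and> i \<le> n - 1})"

end

theory Submission
  imports Defs
begin

text \<open>Write a sum of chord lengths as the sum over \<open>k\<close> of the number of chords of length at least
  \<open>k\<close>. It then suffices that, for \<open>k \<ge> 2\<close>, at most \<open>n + 1 - 2k\<close> pairwise non-crossing chords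
  of an \<open>n\<close>-cycle have length at least \<open>k\<close>, which is their exact number in the shell graph. Choose
  such a chord with no other one inside one of its two arcs. That arc has at least \<open>k\<close> edges, so
  after cutting it off all the chords lie on a path with at most \<open>n - k\<close> edges, and a path with
  \<open>w\<close> edges carries at most \<open>w + 1 - k\<close> non-crossing intervals of length at least \<open>k\<close>.\<close>

section \<open>Counting non-crossing intervals and chords\<close>

definition noncrossing :: "(nat \<times> nat) set \<Rightarrow> bool" where
  "noncrossing F \<longleftrightarrow> (\<forall>(a, c)\<in>F. \<forall>(b, d)\<in>F. \<not> (a < b \<and> b < c \<and> c < d))"

lemma noncrossingD:
  "noncrossing F \<Longrightarrow> (a, c) \<in> F \<Longrightarrow> (b, d) \<in> F \<Longrightarrow> \<not> (a < b \<and> b < c \<and> c < d)"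
  unfolding noncrossing_def by blast

lemma noncrossing_subset: "noncrossing F \<Longrightarrow> F' \<subseteq> F \<Longrightarrow> noncrossing F'"
  unfolding noncrossing_def by blast

text \<open>Induction on the width \<open>r - l\<close>. The full interval \<open>(l, r)\<close>
  accounts for at most one element. If no other interval starts at \<open>l\<close>, the left end
  can be moved up by one; otherwise the longest other one, \<open>(l, m)\<close>, splits the rest
  into intervals left and right of \<open>m\<close>.\<close>

lemma card_noncrossing_intervals_le:
  assumes "2 \<le> k" "noncrossing F" "\<And>x y. (x, y) \<in> F \<Longrightarrow> l \<le> x \<and> x + k \<le> y \<and> y \<le> r"
  shows "card F \<le> r + 1 - l - k"
  using assms
proof (induction "r - l" arbitrary: l r F rule: less_induct)
  case less
  note within = less.prems(3)
  have fin: "finite F"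
    by (rule finite_subset[of _ "{..r} \<times> {..r}"]) (use within in fastforce)+
  show ?case
  proof (cases "l + k \<le> r")
    case False
    then have "F = {}"
      using within by fastforce
    then show ?thesis by simp
  next
    case True
    define F' where "F' = F - {(l, r)}"
    have F': "noncrossing F'" "finite F'" "F' \<subseteq> F"
      using fin noncrossing_subset[OF less.prems(2), of F'] by (auto simp: F'_def)
    have "card F' \<le> r - l - k"
    proof (cases "\<exists>y. (l, y) \<in> F'")
      case False
      have "card F' \<le> r + 1 - Suc l - k"
      proof (rule less.hyps)
        show "r - Suc l < r - l" using True less.prems(1) by simp
        show "Suc l \<le> x \<and> x + k \<le> y \<and> y \<le> r" if "(x, y) \<in> F'" for x y
        proof -
          have "x \<noteq> l" using that False by blast
          moreover have "l \<le> x \<and> x + k \<le> y \<and> y \<le> r" using that F'(3) within by blast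
          ultimately show ?thesis by simp
        qed
      qed (use less.prems F' in auto)
      then show ?thesis by simp
    next
      case ex: True
      define m where "m = Max {y. (l, y) \<in> F'}"
      have finY: "finite {y. (l, y) \<in> F'}"
        by (rule finite_subset[of _ "snd ` F'"]) (use F' in force)+
      have m: "(l, m) \<in> F'"
        using Max_in[OF finY] ex by (auto simp: m_def)
      have max: "y \<le> m" if "(l, y) \<in> F'" for y
        using Max_ge[OF finY] that by (simp add: m_def)
      have lm: "l + k \<le> m" "m \<le> r"
        using within[of l m] m F'(3) by blast+
      have "m \<noteq> r" using m by (auto simp: F'_def)
      with lm have mr: "m < r" by simp
      define A where "A = {(x, y) \<in> F'. y \<le> m}"
      define B where "B = {(x, y) \<in> F'. m \<le> x}"
      have "F' \<subseteq> A \<union> B"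
      proof clarify
        fix x y assume xy: "(x, y) \<in> F'" "(x, y) \<notin> B"
        then have "x < m" by (simp add: B_def)
        \<comment> \<open>An interval with \<open>x < m < y\<close> either starts at
          \<open>l\<close>, against the choice of \<open>m\<close>, or crosses
          \<open>(l, m)\<close>.\<close>
        have "y \<le> m"
        proof (rule ccontr)
          assume "\<not> y \<le> m"
          moreover have "l \<le> x" using within xy F' by blast
          ultimately show False
            using noncrossingD[OF F'(1) m xy(1)] max xy(1) \<open>x < m\<close>
            by (cases "x = l") auto
        qed
        then show "(x, y) \<in> A" using xy by (simp add: A_def)
      qed
      then have "card F' \<le> card (A \<union> B)"
        by (rule card_mono[rotated]) (use F' in \<open>auto simp: A_def B_def intro: finite_subset[of _ F']\<close>)
      also have "\<dots> \<le> card A + card B" by (rule card_Un_le)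
      finally have "card F' \<le> card A + card B" .
      moreover have "card A \<le> m + 1 - l - k"
        by (rule less.hyps)
          (use less.prems(1) F' lm mr within in \<open>auto simp: A_def intro: noncrossing_subset[OF F'(1)]\<close>)
      moreover have "card B \<le> r + 1 - m - k"
        by (rule less.hyps)
          (use less.prems(1) F' lm mr within in \<open>auto simp: B_def intro: noncrossing_subset[OF F'(1)]\<close>)
      \<comment> \<open>The two bounds add up to \<open>r + 2 - l - 2 * k\<close>, at most
        \<open>r - l - k\<close> because \<open>2 \<le> k\<close>. If the bound for \<open>B\<close>
        truncates to 0, then \<open>m < r\<close> suffices for \<open>A\<close> alone.\<close>
      ultimately show ?thesis
        using lm mr less.prems(1) by linarith
    qed
    moreover have "card F \<le> Suc (card F')"
      unfolding F'_def by (simp add: card_Diff_singleton_if) linarith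
    ultimately show ?thesis using True by linarith
  qed
qed

lemma card_noncrossing_chords_le:
  assumes "2 \<le> k" "noncrossing F"
    and long: "\<And>x y. (x, y) \<in> F \<Longrightarrow> x + k \<le> y \<and> y < n \<and> y - x + k \<le> n"
  shows "card F \<le> n + 1 - 2 * k"
proof (cases "F = {}")
  case False
  obtain a b where ab: "(a, b) \<in> F" and min: "\<And>x y. (x, y) \<in> F \<Longrightarrow> b - a \<le> y - x"
    using ex_has_least_nat[of "\<lambda>p. p \<in> F" _ "\<lambda>(x, y). y - x"] False by fast
  have ab': "a + k \<le> b" "b < n" using long[OF ab] by auto
  \<comment> \<open>No chord crosses \<open>(a, b)\<close>, and by minimality of
    \<open>b - a\<close> no other chord is nested inside it. What is left is to lie on one side of
    it or to enclose it.\<close>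
  have cases: "y \<le> a \<or> b \<le> x \<or> x \<le> a \<and> b \<le> y" if "(x, y) \<in> F" for x y
    using that long[OF that] ab' min[OF that] noncrossingD[OF assms(2) ab that]
      noncrossingD[OF assms(2) that ab] by linarith
  \<comment> \<open>the rotation that makes the arc from \<open>b\<close> through \<open>0\<close> to \<open>a\<close> the interval from \<open>b\<close> to \<open>a + n\<close>\<close>
  define g where "g = (\<lambda>(x, y). if y \<le> a then (x + n, y + n) else if b \<le> x then (x, y) else (y, x + n))"
  have inj: "inj_on g F"
  proof (rule inj_onI, clarify)
    fix x y x' y' assume "(x, y) \<in> F" "(x', y') \<in> F" "g (x, y) = g (x', y')"
    then show "x = x' \<and> y = y'"
      using long[of x y] long[of x' y'] cases[of x y] cases[of x' y'] ab'
      by (auto simp: g_def split: if_splits)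
  qed
  have "card (g ` F) \<le> (a + n) + 1 - b - k"
  proof (rule card_noncrossing_intervals_le)
    show "noncrossing (g ` F)"
      unfolding noncrossing_def
    proof (clarify)
      fix p q p' q' x y x' y'
      assume *: "(p, q) = g (x, y)" "(p', q') = g (x', y')" "p < p'" "p' < q" "q < q'"
        and F: "(x, y) \<in> F" "(x', y') \<in> F"
      show False
        using * long[OF F(1)] long[OF F(2)] cases[OF F(1)] cases[OF F(2)] ab'
          noncrossingD[OF assms(2) F] noncrossingD[OF assms(2) F(2,1)]
        by (auto simp: g_def split: if_splits)
    qed
    \<comment> \<open>A chord enclosing \<open>(a, b)\<close> is replaced by its other arc, of
      length \<open>n - (y - x)\<close>; it is at least \<open>k\<close> by the last part of
      \<open>long\<close>.\<close>
    show "b \<le> p \<and> p + k \<le> q \<and> q \<le> a + n" if "(p, q) \<in> g ` F" for p q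
    proof -
      obtain x y where F: "(x, y) \<in> F" and *: "(p, q) = g (x, y)" using \<open>(p, q) \<in> g ` F\<close> by auto
      show ?thesis
        using * long[OF F] cases[OF F] ab' by (auto simp: g_def split: if_splits)
    qed
  qed (use assms in simp)
  \<comment> \<open>Since \<open>a + k \<le> b\<close>, the bound \<open>a + n + 1 - b - k\<close>
    is at most \<open>n + 1 - 2 * k\<close>.\<close>
  then show ?thesis
    using card_image[OF inj] ab' by linarith
qed simp

section \<open>Summing lengths by thresholds\<close>

lemma sum_eq_sum_card_ge:
  fixes f :: "'b \<Rightarrow> nat"
  assumes "finite A" "\<And>x. x \<in> A \<Longrightarrow> f x \<le> N"
  shows "sum f A = (\<Sum>k = 1..N. card {x \<in> A. k \<le> f x})"
proof -
  have "sum f A = (\<Sum>x\<in>A. card {k \<in> {1..N}. k \<le> f x})"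
  proof (rule sum.cong)
    fix x assume "x \<in> A"
    then have "{k \<in> {1..N}. k \<le> f x} = {1..f x}" using assms(2) by force
    then show "f x = card {k \<in> {1..N}. k \<le> f x}" by simp
  qed simp
  also have "\<dots> = (\<Sum>x\<in>A. \<Sum>k = 1..N. if k \<le> f x then 1 else 0)"
    by (intro sum.cong) (simp_all add: sum.If_cases Int_def)
  also have "\<dots> = (\<Sum>k = 1..N. \<Sum>x\<in>A. if k \<le> f x then 1 else 0)"
    by (rule sum.swap)
  also have "\<dots> = (\<Sum>k = 1..N. card {x \<in> A. k \<le> f x})"
    using assms(1) by (intro sum.cong) (simp_all add: sum.If_cases Int_def)
  finally show ?thesis .
qed

text \<open>The right side is the total for the fan of chords at one vertex. The two sums are
  compared threshold by threshold.\<close>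

lemma sum_lengths_noncrossing_le:
  assumes nc: "noncrossing F"
    and chord: "\<And>x y. (x, y) \<in> F \<Longrightarrow> x + 2 \<le> y \<and> y < n \<and> y - x + 2 \<le> n"
  shows "(\<Sum>(x, y)\<in>F. min (y - x) (n - (y - x))) \<le> (\<Sum>i = 2..n - 2. min i (n - i))"
proof -
  define f where "f = (\<lambda>(x, y). min (y - x) (n - (y - x)))"
  have fin: "finite F"
    by (rule finite_subset[of _ "{..n} \<times> {..n}"]) (use chord in fastforce)+
  have "card {p \<in> F. k \<le> f p} \<le> card {i \<in> {2..n - 2}. k \<le> min i (n - i)}" if "k \<in> {1..n}" for k
  proof -
    \<comment> \<open>every chord has length at least 2, so the case \<open>k = 1\<close> reduces to \<open>k = 2\<close>\<close>
    define m where "m = max 2 k"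
    have "{p \<in> F. k \<le> f p} = {p \<in> F. m \<le> f p}"
      using chord by (fastforce simp: m_def f_def)
    moreover have "card {p \<in> F. m \<le> f p} \<le> n + 1 - 2 * m"
    proof (rule card_noncrossing_chords_le)
      show "noncrossing {p \<in> F. m \<le> f p}" using nc by (rule noncrossing_subset) blast
      show "x + m \<le> y \<and> y < n \<and> y - x + m \<le> n" if "(x, y) \<in> {p \<in> F. m \<le> f p}" for x y
        using that chord[of x y] by (auto simp: f_def)
    qed (simp add: m_def)
    \<comment> \<open>This interval has exactly \<open>n + 1 - 2 * m\<close> elements: the fan
      attains the bound at every threshold.\<close>
    moreover have "{i \<in> {2..n - 2}. k \<le> min i (n - i)} = {m..n - m}"
      using that by (auto simp: m_def)
    ultimately show ?thesis by simp
  qed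
  then have "sum f F \<le> (\<Sum>i = 2..n - 2. min i (n - i))"
    using fin chord
    by (subst (1 2) sum_eq_sum_card_ge[where N = n]) (auto simp: f_def intro!: sum_mono)
  then show ?thesis by (simp add: f_def)
qed

section \<open>Upper bound for an arbitrary outerplanar drawing\<close>

lemma is_path_map_nth:
  assumes "distinct vs" "is \<noteq> []" "distinct is" "set is \<subseteq> {..<length vs}"
    and "successively (\<lambda>i j. {vs ! i, vs ! j} \<in> E) is"
  shows "is_path E (map ((!) vs) is)"
  using assms by (auto simp: is_path_def distinct_map successively_map inj_on_nth subset_eq)

lemma successively_upt:
  "(\<And>i. a \<le> i \<Longrightarrow> Suc i < b \<Longrightarrow> P i (Suc i)) \<Longrightarrow> successively P [a..<b]"
  by (auto simp: successively_conv_nth)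

lemma chord_length_le:
  assumes "is_path (cycle_edges (outer_cycle G)) p" "e = {hd p, last p}"
  shows "chord_length G e \<le> length p - 1"
  unfolding chord_length_def
  by (rule Least_le) (use assms in \<open>auto simp: is_path_def intro!: exI[of _ p]\<close>)

lemma cycle_edges_SucI: "Suc i < length vs \<Longrightarrow> {vs ! i, vs ! Suc i} \<in> cycle_edges vs"
  unfolding cycle_edges_def by (auto intro!: exI[of _ i])

lemma cycle_edges_lastI: "Suc i = length vs \<Longrightarrow> {vs ! i, vs ! 0} \<in> cycle_edges vs"
  unfolding cycle_edges_def by (auto intro!: exI[of _ i])

text \<open>Both arcs of the cycle between the two positions are paths. This inequality suffices for
  an arbitrary drawing; the matching lower bound is proved for the shell graph.\<close>

lemma chord_length_le_min:
  assumes "distinct (outer_cycle G)" "a < b" "b < order G"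
  shows "chord_length G {outer_cycle G ! a, outer_cycle G ! b} \<le> min (b - a) (order G - (b - a))"
proof -
  define vs where "vs = outer_cycle G"
  define n where "n = length vs"
  have n: "order G = n" by (simp add: order_def n_def vs_def)
  have bn: "b < n" using assms n by simp
  let ?p = "map ((!) vs) [a..<Suc b]"
  have "is_path (cycle_edges vs) ?p"
    by (rule is_path_map_nth, use assms bn in \<open>simp_all del: upt_Suc add: vs_def[symmetric] n_def[symmetric]\<close>)
      (use bn in \<open>auto simp del: upt_Suc simp: n_def intro!: successively_upt cycle_edges_SucI\<close>)
  moreover have "{vs ! a, vs ! b} = {hd ?p, last ?p}"
    using assms(2) by (simp add: hd_map last_map hd_upt del: upt_Suc)
  ultimately have 1: "chord_length G {vs ! a, vs ! b} \<le> b - a"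
    using chord_length_le[of G ?p] by (simp add: vs_def del: upt_Suc)
  \<comment> \<open>The arc that wraps around from position \<open>n - 1\<close> to 0; it has
    \<open>n - (b - a)\<close> edges.\<close>
  let ?q = "map ((!) vs) ([b..<n] @ [0..<Suc a])"
  have "is_path (cycle_edges vs) ?q"
    by (rule is_path_map_nth, use assms bn in \<open>simp_all del: upt_Suc add: vs_def[symmetric] n_def[symmetric]\<close>)
      (use bn assms(2) in \<open>auto simp del: upt_Suc simp: n_def successively_append_iff 
        intro!: successively_upt cycle_edges_SucI cycle_edges_lastI\<close>)
  moreover have "{vs ! a, vs ! b} = {hd ?q, last ?q}"
    using assms(2) bn by (auto simp: hd_append hd_map)
  ultimately have "chord_length G {vs ! a, vs ! b} \<le> n - (b - a)"
    using chord_length_le[of G ?q] assms(2) bn by (simp add: vs_def del: upt_Suc)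
  with 1 show ?thesis by (simp add: n vs_def)
qed

lemma TCL_le:
  assumes "outerplanar G" "order G = n"
  shows "TCL G \<le> (\<Sum>i = 2..n - 2. min i (n - i))"
proof -
  define vs where "vs = outer_cycle G"
  have len: "length vs = n" and dist: "distinct vs" and "3 \<le> n"
    using assms by (auto simp: order_def outerplanar_def vs_def)
  define F where "F = {(a, b). a < b \<and> b < n \<and> {vs ! a, vs ! b} \<in> chords G}"
  have fin: "finite F"
    by (rule finite_subset[of _ "{..n} \<times> {..n}"]) (auto simp: F_def)
  have sub: "chords G \<subseteq> (\<lambda>(a, b). {vs ! a, vs ! b}) ` F"
  proof
    fix e assume e: "e \<in> chords G"
    then have "e \<in> edges G" by (simp add: chords_def)
    then obtain u v where uv: "e = {u, v}" "u \<in> set vs" "v \<in> set vs" "u \<noteq> v"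
      using assms(1) unfolding outerplanar_def vs_def by blast
    then obtain i j where ij: "i < n" "j < n" "u = vs ! i" "v = vs ! j" "i \<noteq> j"
      by (metis in_set_conv_nth len)
    show "e \<in> (\<lambda>(a, b). {vs ! a, vs ! b}) ` F"
    proof (cases "i < j")
      case True
      then have "(i, j) \<in> F" using ij e uv by (simp add: F_def)
      then show ?thesis using uv ij by (intro image_eqI[of _ _ "(i, j)"]) auto
    next
      case False
      then have "(j, i) \<in> F" using ij e uv by (simp add: F_def insert_commute)
      then show ?thesis using uv ij by (intro image_eqI[of _ _ "(j, i)"]) auto
    qed
  qed
  \<comment> \<open>Passing to a superset of the chords and then to a possibly repetitive indexing
    by \<open>F\<close> can only increase a sum of naturals.\<close>
  have "TCL G \<le> (\<Sum>e\<in>(\<lambda>(a, b). {vs ! a, vs ! b}) ` F. chord_length G e)"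
    unfolding TCL_def by (rule sum_mono2) (use fin sub in auto)
  also have "\<dots> \<le> (\<Sum>(a, b)\<in>F. chord_length G {vs ! a, vs ! b})"
    using sum_image_le[OF fin, of "chord_length G" "\<lambda>(a, b). {vs ! a, vs ! b}"]
    by (simp add: case_prod_unfold o_def)
  also have "\<dots> \<le> (\<Sum>(a, b)\<in>F. min (b - a) (n - (b - a)))"
  proof (rule sum_mono, clarify)
    fix a b assume "(a, b) \<in> F"
    then show "chord_length G {vs ! a, vs ! b} \<le> min (b - a) (n - (b - a))"
      using chord_length_le_min[of G a b] dist assms(2) by (simp add: F_def vs_def)
  qed
  also have "\<dots> \<le> (\<Sum>i = 2..n - 2. min i (n - i))"
  proof (rule sum_lengths_noncrossing_le)
    show "noncrossing F"
      unfolding noncrossing_def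
    proof clarify
      fix a c b d assume *: "(a, c) \<in> F" "(b, d) \<in> F" "a < b" "b < c" "c < d"
      then have "cross vs {vs ! a, vs ! c} {vs ! b, vs ! d}"
        unfolding cross_def using len by (intro exI[of _ a] exI[of _ b] exI[of _ c] exI[of _ d]) (simp add: F_def)
      then show False
        using * assms(1) by (auto simp: F_def chords_def outerplanar_def vs_def)
    qed
    \<comment> \<open>A chord is not a cycle edge: excluding consecutive positions gives the first
      inequality, excluding the closing pair \<open>(0, n - 1)\<close> the last.\<close>
    show "x + 2 \<le> y \<and> y < n \<and> y - x + 2 \<le> n" if "(x, y) \<in> F" for x y
    proof -
      have xy: "x < y" "y < n" "{vs ! x, vs ! y} \<notin> cycle_edges vs"
        using that by (auto simp: F_def chords_def vs_def)
      then have "y \<noteq> Suc x" using cycle_edges_SucI[of x vs] len by auto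
      moreover have "\<not> (x = 0 \<and> Suc y = n)"
        using xy cycle_edges_lastI[of y vs] len by (auto simp: insert_commute)
      ultimately show ?thesis using xy by linarith
    qed
  qed
  finally show ?thesis .
qed

section \<open>Edges, chords and chord lengths of the shell graph\<close>

lemma cycle_edges_upt:
  assumes "3 \<le> n"
  shows "cycle_edges [1..<Suc n] = insert {1, n} {{i, Suc i} | i. 1 \<le> i \<and> i < n}"
proof -
  have "[1..<Suc n] ! j = Suc j" if "j < n" for j
    using that by (simp add: nth_upt del: upt_Suc)
  then have "cycle_edges [1..<Suc n] = {{Suc i, Suc (Suc i mod n)} | i. i < n}"
    unfolding cycle_edges_def using assms
    by (intro Collect_cong ex_cong1 rev_conj_cong) (simp_all del: upt_Suc)
  then have "e \<in> cycle_edges [1..<Suc n] \<longleftrightarrow> (\<exists>i<n. e = {Suc i, Suc (Suc i mod n)})" for e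
    by (simp only: mem_Collect_eq) blast
  moreover have "(\<exists>i<n. e = {Suc i, Suc (Suc i mod n)}) \<longleftrightarrow>
    e = {1, n} \<or> (\<exists>i. e = {i, Suc i} \<and> 1 \<le> i \<and> i < n)" (is "?L = ?R") for e
  proof
    assume ?L
    then obtain i where i: "i < n" "e = {Suc i, Suc (Suc i mod n)}" by blast
    show ?R
    proof (cases "Suc i = n")
      case True
      then show ?thesis using i by (auto simp: insert_commute)
    next
      case False
      then show ?thesis using i by (auto intro!: exI[of _ "Suc i"])
    qed
  next
    assume ?R
    then show ?L
    proof
      assume "e = {1, n}"
      then show ?L using assms by (intro exI[of _ "n - 1"]) auto
    next
      assume "\<exists>i. e = {i, Suc i} \<and> 1 \<le> i \<and> i < n"
      then obtain i where "1 \<le> i" "i < n" "e = {i, Suc i}" by blast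
      then show ?L by (intro exI[of _ "i - 1"]) auto
    qed
  qed
  ultimately show ?thesis by (intro set_eqI) (simp only: insert_iff mem_Collect_eq)
qed

text \<open>The closing cycle edge \<open>{1, n}\<close> is absorbed into the fan, so every edge
  either joins consecutive numbers or contains 1. Crossings are then easy to exclude.\<close>

lemma edges_shell:
  assumes "3 \<le> n"
  shows "edges (shell n) =
    {{i, Suc i} | i. 1 \<le> i \<and> i < n} \<union> {{1, i} | i. 3 \<le> i \<and> i \<le> n}"
proof -
  have "{{1, i} | i. 3 \<le> i \<and> i \<le> n} = insert {1, n} {{1, i} | i. 3 \<le> i \<and> i \<le> n - 1}"
    using assms by (auto simp: le_diff_conv)
  then show ?thesis
    using cycle_edges_upt[OF assms] by (auto simp: shell_def)
qed

text \<open>With the end written \<open>Suc i\<close>, the index \<open>i\<close> counts the cycle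
  edges from 1 up to that end, as in the sum to be compared.\<close>

lemma chords_shell:
  assumes "5 \<le> n"
  shows "chords (shell n) = (\<lambda>i. {1, Suc i}) ` {2..n - 2}"
proof -
  have "{1, i} \<notin> cycle_edges [1..<Suc n]" if "3 \<le> i" "i \<le> n - 1" for i
    using that assms by (auto simp: cycle_edges_upt doubleton_eq_iff simp del: upt_Suc One_nat_def)
  then have "chords (shell n) = {{1, i} | i. 3 \<le> i \<and> i \<le> n - 1}"
    by (auto simp: chords_def shell_def simp del: upt_Suc)
  also have "\<dots> = (\<lambda>i. {1, i}) ` {3..n - 1}" by auto
  also have "{3..n - 1} = Suc ` {2..n - 2}"
    unfolding image_Suc_atLeastAtMost using assms by (intro arg_cong2[where f = atLeastAtMost]) auto
  finally show ?thesis by (simp only: image_image)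
qed

text \<open>A potential changing by at most 1 along each edge changes by at most the number of edges
  along a path. \<open>lip\<close> yields both directions because \<open>{u, v}\<close> is
  unordered.\<close>

lemma potential_path_le:
  fixes h :: "'b \<Rightarrow> nat"
  assumes "successively (\<lambda>u v. {u, v} \<in> E) p" "p \<noteq> []"
    and lip: "\<And>u v. {u, v} \<in> E \<Longrightarrow> h v \<le> Suc (h u)"
  shows "h (hd p) < h (last p) + length p \<and> h (last p) < h (hd p) + length p"
  using assms(1,2)
proof (induction p rule: induct_list012)
  case (3 x y zs)
  then have "h y \<le> Suc (h x)" "h x \<le> Suc (h y)"
    using lip[of x y] lip[of y x] by (auto simp: insert_commute)
  then show ?case using 3 by auto
qed auto

text \<open>The potential \<open>h\<close> is 0 at vertex 1 and \<open>min i (n - i)\<close> at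
  \<open>Suc i\<close>, and changes by at most 1 along cycle edges, so every connecting path has at
  least that many edges.\<close>

lemma chord_length_shell_ge:
  assumes "5 \<le> n" "2 \<le> i" "i \<le> n - 2"
  shows "min i (n - i) \<le> chord_length (shell n) {1, Suc i}"
proof -
  let ?E = "cycle_edges [1..<Suc n]"
  \<comment> \<open>the distance in the cycle from the vertex 1\<close>
  define h where "h = (\<lambda>v. min (v - 1) (n + 1 - v))"
  have lip: "h v \<le> Suc (h u)" if "{u, v} \<in> ?E" for u v
    using that assms by (auto simp: cycle_edges_upt doubleton_eq_iff h_def simp del: upt_Suc One_nat_def)
  have ge: "min i (n - i) \<le> k"
    if "is_path ?E p" "{1, Suc i} = {hd p, last p}" "length p = Suc k" for p k
    using potential_path_le[of ?E p h] lip that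
    by (auto simp: is_path_def doubleton_eq_iff h_def simp del: upt_Suc)
  define P where "P = (\<lambda>k. \<exists>p. is_path ?E p \<and> {1, Suc i} = {hd p, last p} \<and> length p = Suc k)"
  \<comment> \<open>\<open>LEAST\<close> is attained only if some path exists; the arc through 1, 2,
    ..., \<open>Suc i\<close> is one.\<close>
  let ?p = "map ((!) [1..<Suc n]) [0..<Suc i]"
  have "is_path ?E ?p"
    by (rule is_path_map_nth)
      (use assms in \<open>auto simp del: upt_Suc intro!: successively_upt cycle_edges_SucI\<close>)
  moreover have "{1, Suc i} = {hd ?p, last ?p}"
    using assms by (simp add: hd_map last_map nth_upt hd_upt del: upt_Suc)
  ultimately have "P i" unfolding P_def by (intro exI[of _ ?p]) (simp del: upt_Suc)
  then have "P (LEAST k. P k)" by (rule LeastI)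
  then have "min i (n - i) \<le> (LEAST k. P k)"
    unfolding P_def using ge by blast
  then show ?thesis by (simp add: chord_length_def P_def shell_def del: upt_Suc)
qed

lemma TCL_shell_ge:
  assumes "5 \<le> n"
  shows "(\<Sum>i = 2..n - 2. min i (n - i)) \<le> TCL (shell n)"
proof -
  have "inj_on (\<lambda>i. {1, Suc i}) {2..n - 2}"
    by (auto simp: inj_on_def doubleton_eq_iff)
  then have "TCL (shell n) = (\<Sum>i = 2..n - 2. chord_length (shell n) {1, Suc i})"
    by (simp add: TCL_def chords_shell[OF assms] sum.reindex)
  also have "\<dots> \<ge> (\<Sum>i = 2..n - 2. min i (n - i))"
    using assms by (intro sum_mono chord_length_shell_ge) auto
  finally show ?thesis .
qed

section \<open>The shell graph is maximal outerplanar\<close>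

lemma outerplanar_shell:
  assumes "5 \<le> n"
  shows "outerplanar (shell n)"
proof -
  have vs: "outer_cycle (shell n) = [1..<Suc n]" by (simp add: shell_def)
  have e: "edges (shell n) =
    {{i, Suc i} | i. 1 \<le> i \<and> i < n} \<union> {{1, i} | i. 3 \<le> i \<and> i \<le> n}"
    using assms by (intro edges_shell) simp
  \<comment> \<open>In a crossing, the pair \<open>{Suc b, Suc d}\<close> avoids vertex 1, as
    \<open>a < b\<close>, and is not consecutive, as \<open>c\<close> lies between.\<close>
  have no: False
    if "a < b" "b < c" "c < d" "d < n" "{Suc b, Suc d} \<in> edges (shell n)" for a b c d
    using that by (auto simp: e doubleton_eq_iff)
  have "\<not> cross [1..<Suc n] e f" if "e \<in> edges (shell n)" "f \<in> edges (shell n)" for e f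
    using that no by (auto simp: cross_def nth_upt simp del: upt_Suc)
  moreover have "edges (shell n) \<subseteq> {{u, v} | u v. u \<in> {1..n} \<and> v \<in> {1..n} \<and> u \<noteq> v}"
  proof
    fix x assume "x \<in> edges (shell n)"
    then consider i where "x = {i, Suc i}" "1 \<le> i" "i < n" | i where "x = {1, i}" "3 \<le> i" "i \<le> n"
      unfolding e by blast
    then show "x \<in> {{u, v} | u v. u \<in> {1..n} \<and> v \<in> {1..n} \<and> u \<noteq> v}"
    proof cases
      case 1
      then show ?thesis by (intro CollectI exI[of _ i] exI[of _ "Suc i"]) simp
    next
      case 2
      then show ?thesis by (intro CollectI exI[of _ 1] exI[of _ i]) simp
    qed
  qed
  moreover have "cycle_edges [1..<Suc n] \<subseteq> edges (shell n)" by (auto simp: shell_def)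
  moreover have "set [1..<Suc n] = {1..n}" by auto
  ultimately show ?thesis
    unfolding outerplanar_def vs using assms by (simp del: upt_Suc)
qed

lemma maximal_outerplanar_shell:
  assumes "5 \<le> n"
  shows "maximal_outerplanar (shell n)"
  unfolding maximal_outerplanar_def
proof (intro conjI allI impI)
  show "outerplanar (shell n)" using assms by (rule outerplanar_shell)
  fix F assume F: "edges (shell n) \<subseteq> F \<and> outerplanar (Drawing (outer_cycle (shell n)) F)"
  have e: "edges (shell n) =
    {{i, Suc i} | i. 1 \<le> i \<and> i < n} \<union> {{1, i} | i. 3 \<le> i \<and> i \<le> n}"
    using assms by (intro edges_shell) simp
  have vs: "outer_cycle (shell n) = [1..<Suc n]" by (simp add: shell_def)
  have mem: "{u, v} \<in> edges (shell n)" if "{u, v} \<in> F" "1 \<le> u" "u < v" "v \<le> n" for u v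
  proof (cases "v = Suc u \<or> u = 1")
    case True
    then show ?thesis using that by (cases "v = Suc u") (auto simp: e)
  next
    case False
    then have *: "1 < u" "Suc u < v" using that by auto
    obtain u' v' where [simp]: "u = Suc u'" "v = Suc v'"
      using * by (metis less_imp_Suc_add)
    \<comment> \<open>A new edge would separate \<open>Suc u\<close> from 1 and so cross the fan
      edge between them. Vertex \<open>j\<close> sits at position \<open>j - 1\<close>, hence the
      witnesses 0, \<open>u'\<close>, \<open>u\<close>, \<open>v'\<close>.\<close>
    have "cross [1..<Suc n] {1, Suc u} {u, v}"
      unfolding cross_def using * that
      by (intro exI[of _ 0] exI[of _ u'] exI[of _ u] exI[of _ v'])
        (simp add: nth_upt del: upt_Suc)
    moreover have "{1, Suc u} \<in> edges (shell n)"
      unfolding e using * that by (intro UnI2 CollectI exI[of _ "Suc u"]) simp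
    ultimately have False
      using F that(1) unfolding outerplanar_def vs drawing.sel by blast
    then show ?thesis ..
  qed
  have "F \<subseteq> edges (shell n)"
  proof
    fix x assume x: "x \<in> F"
    then obtain u v where uv: "x = {u, v}" "u \<in> set [1..<Suc n]" "v \<in> set [1..<Suc n]" "u \<noteq> v"
      using F unfolding outerplanar_def vs drawing.sel by blast
    then show "x \<in> edges (shell n)"
      using mem[of u v] mem[of v u] x by (cases "u < v") (auto simp: insert_commute simp del: upt_Suc)
  qed
  with F show "F = edges (shell n)" by blast
qed

section \<open>Comparison through the common value of the two bounds\<close>

theorem theorem5:
  fixes n :: nat
  assumes "5 \<le> n"
  shows "order (shell n) = n \<and> maximal_outerplanar (shell n) \<and>
    (\<forall>G :: 'a drawing. maximal_outerplanar G \<and> order G = n \<longrightarrow> TCL G \<le> TCL (shell n))"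
proof (intro conjI allI impI)
  show "order (shell n) = n" by (simp add: order_def shell_def)
  show "maximal_outerplanar (shell n)" using assms by (rule maximal_outerplanar_shell)
  fix G :: "'a drawing" assume "maximal_outerplanar G \<and> order G = n"
  then have "TCL G \<le> (\<Sum>i = 2..n - 2. min i (n - i))"
    by (intro TCL_le) (auto simp: maximal_outerplanar_def)
  also have "\<dots> \<le> TCL (shell n)" using assms by (rule TCL_shell_ge)
  finally show "TCL G \<le> TCL (shell n)" .
qed

end
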